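(* Let $p=p(n)$ be a function with $n\,p(n)\to\infty$ as $n\to\infty$. For every $n$, let $T$ be a random tournament on alternatives $x_1,\dots,x_n$ generated according to the generalized random model with probabilities $p_{i,j}\ge p(n)$ for all $i\neq j$ (i.e., $p_{i,j}\in\omega(1/n)$ uniformly over all pairs). Then with high probability (i.e., with probability tending to $1$ as $n\to\infty$), at least $0.9n$ alternatives in $T$ are $3$-kings.
   Context: A tournament on a finite set $V$ of alternatives is a complete orientation: for every two distinct $x,y\in V$ exactly one of $x\succ y$ ("$x$ dominates $y$") or $y\succ x$ holds. An alternative $x$ is a $3$-king if for every other alternative $y$ there is a directed path from $x$ to $y$ of length (number of edges) at most $3$. Generalized random model: for each ordered pair $i\neq j$ there is a number $p_{i,j}\in[0,1]$ with $p_{i,j}+p_{j,i}=1$; independently for each unordered pair $\{i,j\}$, $x_i\succ x_j$ with probability $p_{i,j}$ and otherwise $x_j\succ x_i$. *)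

theory Defs
  imports "HOL-Probability.Probability" "Graph_Theory.Graph_Theory"
begin

locale tournament = pair_digraph T for T :: "'a pair_pre_digraph" +
  assumes complete_orientation:
    "\<lbrakk>x \<in> pverts T; y \<in> pverts T; x \<noteq> y\<rbrakk> \<Longrightarrow> (x, y) \<in> parcs T \<longleftrightarrow> (y, x) \<notin> parcs T"

definition three_king :: "'a pair_pre_digraph \<Rightarrow> 'a \<Rightarrow> bool" where
  "three_king T x \<longleftrightarrow> x \<in> pverts T \<and>
     (\<forall>y \<in> pverts T. y \<noteq> x \<longrightarrow>
        (\<exists>w. pre_digraph.apath (with_proj T) x w y \<and> length w \<le> 3))"

definition upairs :: "nat \<Rightarrow> (nat \<times> nat) set" where
  "upairs n = {(i, j). 1 \<le> i \<and> i < j \<and> j \<le> n}"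

(* An unordered pair {i, j} with i < j is represented by (i, j); its coin shows True
   iff i dominates j. *)
definition tournament_of :: "nat \<Rightarrow> (nat \<times> nat \<Rightarrow> bool) \<Rightarrow> nat pair_pre_digraph" where
  "tournament_of n c =
     \<lparr> pverts = {1..n},
       parcs = {(i, j). (i, j) \<in> upairs n \<and> c (i, j) \<or> (j, i) \<in> upairs n \<and> \<not> c (j, i)} \<rparr>"

(* Only q i j with i < j enters; the model requires q i j + q j i = 1, and under this
   condition arc_prob below covers both orders. bernoulli_pmf clips its parameter to
   [0, 1], so q i j must be assumed to be a probability. *)
definition random_tournament :: "nat \<Rightarrow> (nat \<Rightarrow> nat \<Rightarrow> real) \<Rightarrow> nat pair_pre_digraph pmf" where
  "random_tournament n q =
     map_pmf (tournament_of n)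
       (Pi_pmf (upairs n) False (\<lambda>(i, j). bernoulli_pmf (q i j)))"

lemma finite_upairs [simp]: "finite (upairs n)"
  by (rule finite_subset[of _ "{1..n} \<times> {1..n}"]) (auto simp: upairs_def)

lemma tournament_tournament_of: "tournament (tournament_of n c)"
proof
  show "finite (parcs (tournament_of n c))"
    by (rule finite_subset[of _ "{1..n} \<times> {1..n}"]) (auto simp: tournament_of_def upairs_def)
qed (auto simp: tournament_of_def upairs_def)

lemma random_tournament_tournament:
  "T \<in> set_pmf (random_tournament n q) \<Longrightarrow> tournament T \<and> pverts T = {1..n}"
  by (auto simp: random_tournament_def tournament_tournament_of) (auto simp: tournament_of_def)

lemma arc_prob:
  assumes ij: "i \<in> {1..n}" "j \<in> {1..n}" "i \<noteq> j"
    and q: "0 \<le> q i j" "q i j \<le> 1" "q i j + q j i = 1"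
  shows "measure_pmf.prob (random_tournament n q) {T. (i, j) \<in> parcs T} = q i j"
proof -
  let ?C = "Pi_pmf (upairs n) False (\<lambda>(i, j). bernoulli_pmf (q i j))"
  have comp: "map_pmf (\<lambda>c. c e) ?C = (case e of (i, j) \<Rightarrow> bernoulli_pmf (q i j))"
    if "e \<in> upairs n" for e
    using that by (subst Pi_pmf_component) auto
  have coin: "measure_pmf.prob ?C {c. c (k, l) = b} = pmf (bernoulli_pmf (q k l)) b"
    if "(k, l) \<in> upairs n" for k l b
  proof -
    have "measure_pmf.prob ?C {c. c (k, l) = b} = pmf (map_pmf (\<lambda>c. c (k, l)) ?C) b"
      by (simp add: pmf_map vimage_def)
    then show ?thesis using comp[OF that] by simp
  qed
  have rt: "measure_pmf.prob (random_tournament n q) {T. (i, j) \<in> parcs T} =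
      measure_pmf.prob ?C {c. (i, j) \<in> parcs (tournament_of n c)}"
    by (simp add: random_tournament_def vimage_def)
  show ?thesis
  proof (cases "i < j")
    case True
    then have "{c. (i, j) \<in> parcs (tournament_of n c)} = {c. c (i, j) = True}"
      and "(i, j) \<in> upairs n"
      using ij by (auto simp: tournament_of_def upairs_def)
    then show ?thesis using rt coin[of i j True] q by simp
  next
    case False
    then have "{c. (i, j) \<in> parcs (tournament_of n c)} = {c. c (j, i) = False}"
      and "(j, i) \<in> upairs n"
      using ij by (auto simp: tournament_of_def upairs_def)
    then show ?thesis using rt coin[of j i False] q by simp
  qed
qed

lemma arcs_indep:
  "prob_space.indep_events (random_tournament n q) (\<lambda>e. {T. e \<in> parcs T}) (upairs n)"
proof (subst prob_space.indep_events_def[OF prob_space_measure_pmf], intro conjI allI ballI impI)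
  let ?C = "Pi_pmf (upairs n) False (\<lambda>(i, j). bernoulli_pmf (q i j))"
  have rt: "measure_pmf.prob (random_tournament n q) A =
      measure_pmf.prob ?C (tournament_of n -` A)" for A
    by (simp add: random_tournament_def)
  have arc: "tournament_of n -` {T. e \<in> parcs T} = {c. c e}" if "e \<in> upairs n" for e
    using that by (auto simp: tournament_of_def upairs_def)
  let ?b = "\<lambda>(i, j). bernoulli_pmf (q i j)"
  have joint: "measure_pmf.prob ?C (\<Inter>e\<in>K. {c. c e}) =
      (\<Prod>e\<in>K. measure_pmf.prob (?b e) {True})" if K: "K \<subseteq> upairs n" for K
  proof -
    have "(\<Inter>e\<in>K. {c. c e}) = Pi (upairs n) (\<lambda>e. if e \<in> K then {True} else UNIV)"
      using K by (auto simp: Pi_iff split: if_splits)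
    then have "measure_pmf.prob ?C (\<Inter>e\<in>K. {c. c e}) =
        (\<Prod>e\<in>upairs n. measure_pmf.prob (?b e) (if e \<in> K then {True} else UNIV))"
      by (simp only: measure_Pi_pmf_Pi[OF finite_upairs])
    also have "\<dots> = (\<Prod>e\<in>K. measure_pmf.prob (?b e) {True})"
      using K by (intro prod.mono_neutral_cong_right) auto
    finally show ?thesis .
  qed
  fix J assume J: "J \<subseteq> upairs n" "J \<noteq> {}" "finite J"
  have "measure_pmf.prob (random_tournament n q) (\<Inter>e\<in>J. {T. e \<in> parcs T}) =
      measure_pmf.prob ?C (\<Inter>e\<in>J. {c. c e})"
    unfolding rt vimage_INT using J(1) arc by (intro arg_cong[where f = "measure_pmf.prob ?C"] INF_cong) auto
  also have "\<dots> = (\<Prod>e\<in>J. measure_pmf.prob (?b e) {True})"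
    using J(1) by (rule joint)
  also have "\<dots> = (\<Prod>e\<in>J. measure_pmf.prob (random_tournament n q) {T. e \<in> parcs T})"
  proof (rule prod.cong)
    fix e assume "e \<in> J"
    with J(1) have e: "e \<in> upairs n" by auto
    then show "measure_pmf.prob (?b e) {True} =
        measure_pmf.prob (random_tournament n q) {T. e \<in> parcs T}"
      unfolding rt arc[OF e] using joint[of "{e}"] by simp
  qed simp
  finally show "measure_pmf.prob (random_tournament n q) (\<Inter>e\<in>J. {T. e \<in> parcs T}) =
      (\<Prod>e\<in>J. measure_pmf.prob (random_tournament n q) {T. e \<in> parcs T})" .
qed simp

end

theory Submission
  imports Defs
begin

text \<open>Call a vertex \<open>x\<close> rich if it dominates a set \<open>A\<close> of at least \<open>m = 0.04 n\<close> vertices; every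
  tournament has at most \<open>2 m + 1\<close> vertices that are not rich. Fix a rich \<open>x\<close> and \<open>y \<notin> A\<close>. If
  \<open>x\<close> does not reach \<open>y\<close> within three steps, then no \<open>z\<close> with \<open>z \<succ> y\<close> lies in \<open>A\<close> or is
  dominated by a member of \<open>A\<close>. Given \<open>A\<close>, these events for different \<open>z\<close> involve disjoint sets of
  pairs, and a fixed \<open>z\<close> lies in \<open>A\<close> or is dominated from \<open>A\<close> with probability at least \<open>1/2\<close> as
  soon as \<open>p m \<ge> 1\<close>. So \<open>y\<close> is missed with probability at most \<open>exp (- s y / 2)\<close>, where
  \<open>s y\<close> is the expected in-degree of \<open>y\<close> (not counting \<open>x\<close>). Every \<open>r\<close> vertices contain one with
  \<open>s y \<ge> (r - 1) / 2\<close>, and \<open>s y \<ge> (n - 2) p\<close> for all \<open>y\<close>, so the sum of these bounds over \<open>y\<close> is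
  \<open>O (exp (- n p / 8))\<close>. Markov's inequality then bounds the number of rich vertices that are not
  3-kings.\<close>

section \<open>In-weights in weighted tournaments\<close>

text \<open>Adding the sum to its copy with \<open>y\<close> and \<open>z\<close> exchanged gives
  \<open>w z y + w y z\<close>, which is at least 1, for each of the |Y| (|Y| - 1) ordered
  pairs.\<close>

lemma double_sum_ge_card:
  fixes w :: "'a \<Rightarrow> 'a \<Rightarrow> real"
  assumes "finite Y" and w: "\<And>i j. \<lbrakk>i \<in> Y; j \<in> Y; i \<noteq> j\<rbrakk> \<Longrightarrow> w i j + w j i \<ge> 1"
  shows "(\<Sum>y\<in>Y. \<Sum>z\<in>Y - {y}. w z y) \<ge> real (card Y) * (real (card Y) - 1) / 2"
proof -
  let ?S = "SIGMA y:Y. Y - {y}"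
  have "(\<Sum>y\<in>Y. \<Sum>z\<in>Y - {y}. w z y) = (\<Sum>(y, z)\<in>?S. w z y)"
    using assms by (subst sum.Sigma) auto
  moreover have "(\<Sum>(y, z)\<in>?S. w z y) = (\<Sum>(y, z)\<in>?S. w y z)"
    by (rule sum.reindex_bij_witness[where i = prod.swap and j = prod.swap]) auto
  ultimately have "2 * (\<Sum>y\<in>Y. \<Sum>z\<in>Y - {y}. w z y) = (\<Sum>(y, z)\<in>?S. w z y + w y z)"
    by (simp add: sum.distrib case_prod_unfold)
  also have "\<dots> \<ge> (\<Sum>(y, z)\<in>?S. 1)"
    using w by (intro sum_mono) auto
  also have "(\<Sum>(y, z)\<in>?S. 1 :: real) = (\<Sum>y\<in>Y. \<Sum>z\<in>Y - {y}. 1)"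
    using assms by (subst sum.Sigma) auto
  also have "\<dots> = real (card Y) * (real (card Y) - 1)"
  proof (cases "Y = {}")
    case False
    then have "card Y \<ge> 1" using assms by (simp add: card_gt_0_iff Suc_le_eq)
    then show ?thesis using assms by (simp add: of_nat_diff)
  qed simp
  finally show ?thesis by simp
qed

lemma exists_large_in_weight:
  fixes w :: "'a \<Rightarrow> 'a \<Rightarrow> real"
  assumes Y: "finite Y" "Y \<noteq> {}"
    and w: "\<And>i j. \<lbrakk>i \<in> Y; j \<in> Y; i \<noteq> j\<rbrakk> \<Longrightarrow> w i j + w j i \<ge> 1"
  obtains y where "y \<in> Y" "(\<Sum>z\<in>Y - {y}. w z y) \<ge> (real (card Y) - 1) / 2"
proof -
  have "\<exists>y\<in>Y. (\<Sum>z\<in>Y - {y}. w z y) \<ge> (real (card Y) - 1) / 2"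
  proof (rule ccontr)
    assume "\<not> ?thesis"
    then have "(\<Sum>y\<in>Y. \<Sum>z\<in>Y - {y}. w z y) < (\<Sum>y\<in>Y. (real (card Y) - 1) / 2)"
      using Y by (intro sum_strict_mono) auto
    with double_sum_ge_card[OF Y(1), of w, OF w] show False by simp
  qed
  then show ?thesis using that by blast
qed

text \<open>Vertices of \<open>Y\<close> are peeled off one at a time. Among k + 1 remaining
  vertices, averaging yields one whose in-weight from the others is at least k / 2; as weights are
  nonnegative, its in-weight from all of \<open>V\<close> is no smaller.\<close>

lemma sum_antimono_in_weight_le:
  fixes w :: "'a \<Rightarrow> 'a \<Rightarrow> real" and f :: "real \<Rightarrow> real"
  assumes V: "finite V" and f: "antimono f" and YV: "Y \<subseteq> V"
    and nonneg: "\<And>i j. \<lbrakk>i \<in> V; j \<in> V; i \<noteq> j\<rbrakk> \<Longrightarrow> w i j \<ge> 0"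
    and w: "\<And>i j. \<lbrakk>i \<in> V; j \<in> V; i \<noteq> j\<rbrakk> \<Longrightarrow> w i j + w j i \<ge> 1"
  shows "(\<Sum>y\<in>Y. f (\<Sum>z\<in>V - {y}. w z y)) \<le> (\<Sum>r<card Y. f (real r / 2))"
  using YV
proof (induction "card Y" arbitrary: Y)
  case 0
  then have "Y = {}" using V finite_subset[of Y V] by auto
  then show ?case by simp
next
  case (Suc k)
  have fin: "finite Y" using Suc.prems V finite_subset by blast
  have ne: "Y \<noteq> {}" using Suc.hyps(2) by auto
  obtain y where y: "y \<in> Y" "(\<Sum>z\<in>Y - {y}. w z y) \<ge> (real (card Y) - 1) / 2"
    using exists_large_in_weight[OF fin ne, of w] w Suc.prems by (metis subsetD)
  have "(\<Sum>z\<in>Y - {y}. w z y) \<le> (\<Sum>z\<in>V - {y}. w z y)"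
    using V Suc.prems y(1) nonneg by (intro sum_mono2) auto
  with y(2) have "real k / 2 \<le> (\<Sum>z\<in>V - {y}. w z y)"
    by (simp flip: Suc.hyps(2))
  then have *: "f (\<Sum>z\<in>V - {y}. w z y) \<le> f (real k / 2)"
    by (rule antimonoD[OF f])
  have card: "card (Y - {y}) = k" using y(1) fin Suc.hyps(2) by simp
  have "(\<Sum>y\<in>Y. f (\<Sum>z\<in>V - {y}. w z y))
      = f (\<Sum>z\<in>V - {y}. w z y) + (\<Sum>y\<in>Y - {y}. f (\<Sum>z\<in>V - {y}. w z y))"
    using fin y(1) by (rule sum.remove)
  also have "\<dots> \<le> f (real k / 2) + (\<Sum>r<k. f (real r / 2))"
    using * Suc.hyps(1)[of "Y - {y}"] card Suc.prems by (intro add_mono) auto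
  finally show ?case by (simp flip: Suc.hyps(2))
qed

text \<open>The exponent is split into two halves. One half uses the uniform bound \<open>D\<close>;
  the other, with in-weights at least r / 2 for r = 0, 1, ..., is dominated by a geometric series of
  ratio exp (-1/8).\<close>

lemma sum_exp_in_weight_le:
  fixes w :: "'a \<Rightarrow> 'a \<Rightarrow> real" and D :: real
  assumes V: "finite V"
    and nonneg: "\<And>i j. \<lbrakk>i \<in> V; j \<in> V; i \<noteq> j\<rbrakk> \<Longrightarrow> w i j \<ge> 0"
    and w: "\<And>i j. \<lbrakk>i \<in> V; j \<in> V; i \<noteq> j\<rbrakk> \<Longrightarrow> w i j + w j i \<ge> 1"
    and D: "\<And>y. y \<in> V \<Longrightarrow> (\<Sum>z\<in>V - {y}. w z y) \<ge> D"
  shows "(\<Sum>y\<in>V. exp (- (\<Sum>z\<in>V - {y}. w z y) / 2)) \<le> exp (- D / 4) / (1 - exp (- 1 / 8))"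
proof -
  let ?s = "\<lambda>y. \<Sum>z\<in>V - {y}. w z y"
  have "(\<Sum>y\<in>V. exp (- ?s y / 2)) \<le> (\<Sum>y\<in>V. exp (- D / 4) * exp (- ?s y / 4))"
    using D by (intro sum_mono) (force simp flip: exp_add)
  also have "\<dots> = exp (- D / 4) * (\<Sum>y\<in>V. exp (- ?s y / 4))"
    by (simp add: sum_distrib_left)
  also have "(\<Sum>y\<in>V. exp (- ?s y / 4)) \<le> (\<Sum>r<card V. exp (- (real r / 2) / 4))"
    using V nonneg w
    by (intro sum_antimono_in_weight_le[where f = "\<lambda>t. exp (- t / 4)"]) (auto intro: antimonoI)
  also have "\<dots> = (\<Sum>r<card V. exp (- 1 / 8) ^ r)"
    by (intro sum.cong) (simp_all flip: exp_of_nat_mult)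
  also have "\<dots> \<le> (\<Sum>r. exp (- 1 / 8) ^ r)"
    by (intro sum_le_suminf summable_geometric) auto
  also have "\<dots> = 1 / (1 - exp (- 1 / 8))"
    by (rule suminf_geometric) simp
  finally show ?thesis by (simp add: mult_left_mono)
qed

section \<open>Independence of events on disjoint sets of coins\<close>

text \<open>This takes the place of measurability with respect to the coins in
  \<open>J\<close>.\<close>

definition depends_on :: "'a set \<Rightarrow> (('a \<Rightarrow> 'b) \<Rightarrow> bool) \<Rightarrow> bool" where
  "depends_on J P \<longleftrightarrow> (\<forall>c c'. (\<forall>e\<in>J. c e = c' e) \<longrightarrow> P c = P c')"

lemma depends_onD: "depends_on J P \<Longrightarrow> (\<And>e. e \<in> J \<Longrightarrow> c e = c' e) \<Longrightarrow> P c = P c'"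
  unfolding depends_on_def by blast

lemma depends_on_mono: "depends_on J P \<Longrightarrow> J \<subseteq> K \<Longrightarrow> depends_on K P"
  unfolding depends_on_def by blast

lemma depends_on_not: "depends_on J P \<Longrightarrow> depends_on J (\<lambda>c. \<not> P c)"
  unfolding depends_on_def by blast

lemma depends_on_conj: "depends_on J P \<Longrightarrow> depends_on J Q \<Longrightarrow> depends_on J (\<lambda>c. P c \<and> Q c)"
  unfolding depends_on_def by blast

lemma depends_on_all: "(\<And>k. k \<in> K \<Longrightarrow> depends_on J (P k)) \<Longrightarrow> depends_on J (\<lambda>c. \<forall>k\<in>K. P k c)"
  unfolding depends_on_def by blast

lemma prob_pmf_not: "measure_pmf.prob M {c. \<not> P c} = 1 - measure_pmf.prob M {c. P c}"
  using measure_pmf.prob_compl[of "{c. P c}" M] by (simp add: Compl_eq_Diff_UNIV[symmetric] Collect_neg_eq)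

lemma prob_pair_pmf_Times:
  "measure_pmf.prob (pair_pmf M N) (A \<times> B) = measure_pmf.prob M A * measure_pmf.prob N B"
proof -
  \<comment> \<open>Intersecting with the supports makes both sets countable, as
    \<open>measure_pmf_prob_product\<close> requires.\<close>
  have "measure_pmf.prob (pair_pmf M N) (A \<times> B)
      = measure_pmf.prob (pair_pmf M N) ((A \<inter> set_pmf M) \<times> (B \<inter> set_pmf N))"
    by (intro measure_prob_cong_0) (auto simp: pmf_pair set_pmf_iff)
  also have "\<dots> = measure_pmf.prob M (A \<inter> set_pmf M) * measure_pmf.prob N (B \<inter> set_pmf N)"
    by (intro measure_pmf_prob_product) auto
  finally show ?thesis by (simp add: measure_Int_set_pmf)
qed

text \<open>The coins in \<open>J\<close> and those in \<open>I - J\<close> form two independent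
  families; \<open>P\<close> reads only the first and \<open>Q\<close>, since \<open>K\<close>
  avoids \<open>J\<close>, only the second.\<close>

lemma prob_Pi_pmf_conj:
  fixes d :: "'a \<Rightarrow> 'b pmf"
  assumes I: "finite I" and J: "J \<subseteq> I" and K: "K \<subseteq> I" "J \<inter> K = {}"
    and P: "depends_on J P" and Q: "depends_on K Q"
  shows "measure_pmf.prob (Pi_pmf I dflt d) {c. P c \<and> Q c}
    = measure_pmf.prob (Pi_pmf I dflt d) {c. P c} * measure_pmf.prob (Pi_pmf I dflt d) {c. Q c}"
proof -
  let ?M = "Pi_pmf J dflt d" and ?N = "Pi_pmf (I - J) dflt d"
  let ?h = "\<lambda>(f, g) x. if x \<in> J then f x else g x"
  have IJ: "I = J \<union> (I - J)" using J by blast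
  have eq: "Pi_pmf I dflt d = map_pmf ?h (pair_pmf ?M ?N)"
    by (subst IJ, rule Pi_pmf_union) (use I J in \<open>auto intro: finite_subset\<close>)
  have hP: "P (?h fg) = P (fst fg)" for fg
    by (rule depends_onD[OF P]) (auto split: prod.splits)
  have hQ: "Q (?h fg) = Q (snd fg)" for fg
    by (rule depends_onD[OF Q]) (use K in \<open>auto split: prod.splits\<close>)
  have main: "measure_pmf.prob (Pi_pmf I dflt d) {c. P' c \<and> Q' c}
      = measure_pmf.prob ?M {c. P' c} * measure_pmf.prob ?N {c. Q' c}"
    if "\<And>fg. P' (?h fg) = P' (fst fg)" "\<And>fg. Q' (?h fg) = Q' (snd fg)" for P' Q'
  proof -
    have "?h -` {c. P' c \<and> Q' c} = {c. P' c} \<times> {c. Q' c}"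
      using that by auto
    then show ?thesis unfolding eq by (simp add: prob_pair_pmf_Times)
  qed
  \<comment> \<open>The trivial event in one slot identifies the factor in the other slot with a
    probability over all coins.\<close>
  show ?thesis
    using main[of P Q, OF hP hQ] main[of P "\<lambda>_. True", OF hP] main[of "\<lambda>_. True" Q, OF _ hQ] by simp
qed

lemma prob_Pi_pmf_all:
  fixes d :: "'a \<Rightarrow> 'b pmf"
  assumes I: "finite I" and "finite K"
    and "\<And>k. k \<in> K \<Longrightarrow> J k \<subseteq> I" and "disjoint_family_on J K"
    and "\<And>k. k \<in> K \<Longrightarrow> depends_on (J k) (P k)"
  shows "measure_pmf.prob (Pi_pmf I dflt d) {c. \<forall>k\<in>K. P k c}
    = (\<Prod>k\<in>K. measure_pmf.prob (Pi_pmf I dflt d) {c. P k c})"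
  using assms(2-)
proof (induction K rule: finite_induct)
  case (insert k K)
  have "measure_pmf.prob (Pi_pmf I dflt d) {c. P k c \<and> (\<forall>k\<in>K. P k c)}
    = measure_pmf.prob (Pi_pmf I dflt d) {c. P k c} *
      measure_pmf.prob (Pi_pmf I dflt d) {c. \<forall>k\<in>K. P k c}"
  proof (rule prob_Pi_pmf_conj[where J = "J k" and K = "\<Union>(J ` K)"])
    show "J k \<inter> \<Union>(J ` K) = {}"
      using insert.prems(2) insert.hyps by (fastforce simp: disjoint_family_on_def)
    show "depends_on (\<Union>(J ` K)) (\<lambda>c. \<forall>k\<in>K. P k c)"
      using insert.prems(3) by (blast intro: depends_on_all depends_on_mono)
  qed (use I insert.prems in auto)
  also have "measure_pmf.prob (Pi_pmf I dflt d) {c. \<forall>k\<in>K. P k c}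
    = (\<Prod>k\<in>K. measure_pmf.prob (Pi_pmf I dflt d) {c. P k c})"
    using insert.prems by (intro insert.IH) (auto simp: disjoint_family_on_def)
  finally show ?case using insert.hyps by simp
qed simp

section \<open>Paths of length at most three\<close>

definition beats :: "nat \<Rightarrow> (nat \<times> nat \<Rightarrow> bool) \<Rightarrow> nat \<Rightarrow> nat \<Rightarrow> bool" where
  "beats n c i j \<longleftrightarrow> (i, j) \<in> parcs (tournament_of n c)"

definition out :: "nat \<Rightarrow> (nat \<times> nat \<Rightarrow> bool) \<Rightarrow> nat \<Rightarrow> nat set" where
  "out n c x = {z \<in> {1..n}. beats n c x z}"

text \<open>Names the coin shared by both orders of a pair, in the increasing form used by
  \<open>upairs\<close>.\<close>

definition edge :: "nat \<Rightarrow> nat \<Rightarrow> nat \<times> nat" where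
  "edge i j = (min i j, max i j)"

text \<open>Given the set \<open>A\<close> of vertices dominated by \<open>x\<close>, this is the event that some path from \<open>x\<close> to
  \<open>y\<close> of length two or three has \<open>z\<close> as its last vertex before \<open>y\<close>.\<close>
definition gate :: "nat \<Rightarrow> nat set \<Rightarrow> (nat \<times> nat \<Rightarrow> bool) \<Rightarrow> nat \<Rightarrow> nat \<Rightarrow> bool" where
  "gate n A c y z \<longleftrightarrow> beats n c z y \<and> (z \<in> A \<or> (\<exists>a\<in>A. beats n c a z))"

text \<open>For \<open>z \<in> A\<close> the second conjunct of \<open>gate\<close> holds outright,
  so pairs inside \<open>A\<close> are omitted. Otherwise the pair of two members of
  \<open>A\<close> would belong to the sets of both, and disjointness would fail.\<close>

definition gate_edges :: "nat set \<Rightarrow> nat \<Rightarrow> nat \<Rightarrow> (nat \<times> nat) set" where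
  "gate_edges A y z = insert (edge z y) (if z \<in> A then {} else (\<lambda>a. edge a z) ` A)"

lemma edge_in_upairs: "i \<in> {1..n} \<Longrightarrow> j \<in> {1..n} \<Longrightarrow> i \<noteq> j \<Longrightarrow> edge i j \<in> upairs n"
  by (auto simp: edge_def upairs_def)

lemma edge_eq_iff: "edge i j = edge k l \<longleftrightarrow> i = k \<and> j = l \<or> i = l \<and> j = k"
  by (auto simp: edge_def min_def max_def)

lemma beats_iff:
  "i \<in> {1..n} \<Longrightarrow> j \<in> {1..n} \<Longrightarrow> beats n c i j \<longleftrightarrow> (i < j \<and> c (edge i j)) \<or> (j < i \<and> \<not> c (edge i j))"
  by (auto simp: beats_def tournament_of_def edge_def upairs_def)

lemma beats_range: "beats n c i j \<Longrightarrow> i \<in> {1..n} \<and> j \<in> {1..n} \<and> i \<noteq> j"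
  by (auto simp: beats_def tournament_of_def upairs_def)

lemma beats_total: "i \<in> {1..n} \<Longrightarrow> j \<in> {1..n} \<Longrightarrow> i \<noteq> j \<Longrightarrow> beats n c i j \<or> beats n c j i"
  by (auto simp: beats_def tournament_of_def upairs_def)

lemma depends_on_beats:
  assumes "edge i j \<in> J"
  shows "depends_on J (\<lambda>c. beats n c i j)"
proof (cases "i \<in> {1..n} \<and> j \<in> {1..n}")
  case True
  then show ?thesis using assms unfolding depends_on_def by (simp add: beats_iff)
next
  case False
  then have "\<not> beats n c i j" for c using beats_range[of n c i j] by blast
  then show ?thesis unfolding depends_on_def by simp
qed

lemma depends_on_gate: "depends_on (gate_edges A y z) (\<lambda>c. gate n A c y z)"
proof -
  have "depends_on (gate_edges A y z) (\<lambda>c. beats n c z y)"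
    by (rule depends_on_beats) (simp add: gate_edges_def)
  moreover have "depends_on (gate_edges A y z) (\<lambda>c. z \<in> A \<or> (\<exists>a\<in>A. beats n c a z))"
  proof (cases "z \<in> A")
    case False
    then have "depends_on (gate_edges A y z) (\<lambda>c. \<forall>a\<in>A. \<not> beats n c a z)"
      by (intro depends_on_all depends_on_not depends_on_beats) (simp add: gate_edges_def)
    from depends_on_not[OF this] False show ?thesis by simp
  qed (simp add: depends_on_def)
  ultimately show ?thesis unfolding gate_def by (rule depends_on_conj)
qed

lemma depends_on_out: "depends_on ((\<lambda>z. edge x z) ` ({1..n} - {x})) (\<lambda>c. out n c x = A)"
proof -
  let ?J = "(\<lambda>z. edge x z) ` ({1..n} - {x})"
  have "beats n c x z = beats n c' x z"
    if "\<forall>e\<in>?J. c e = c' e" "z \<in> {1..n}" for c c' z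
  proof (cases "z = x")
    case True
    then show ?thesis using beats_range by blast
  next
    case False
    then show ?thesis using that by (intro depends_onD[OF depends_on_beats[of x z ?J]]) auto
  qed
  then have "out n c x = out n c' x" if "\<forall>e\<in>?J. c e = c' e" for c c'
    using that by (auto simp: out_def)
  then show ?thesis unfolding depends_on_def by metis
qed

lemma short_path_if_gate:
  assumes x: "x \<in> {1..n}" and y: "y \<in> {1..n}" "y \<noteq> x"
    and gate: "y \<in> out n c x \<or> (\<exists>z\<in>{1..n} - {x, y}. gate n (out n c x) c y z)"
  shows "\<exists>w. pre_digraph.apath (with_proj (tournament_of n c)) x w y \<and> length w \<le> 3"
proof -
  interpret tournament "tournament_of n c" by (rule tournament_tournament_of)
  have V: "pverts (tournament_of n c) = {1..n}" by (simp add: tournament_of_def)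
  \<comment> \<open>The negative facts in the last case make the walk a genuine path:
    \<open>a\<close> differs from \<open>y\<close> because \<open>x\<close> does not dominate
    \<open>y\<close>.\<close>
  consider "beats n c x y" | z where "z \<noteq> x" "z \<noteq> y" "beats n c x z" "beats n c z y"
    | z a where "z \<noteq> x" "z \<noteq> y" "\<not> beats n c x y" "\<not> beats n c x z" "beats n c x a" "beats n c a z" "beats n c z y"
    using gate unfolding out_def gate_def by fastforce
  then show ?thesis
  proof cases
    case 1
    then have "apath x [(x, y)] y"
      using x y by (simp add: apath_Cons_iff apath_Nil_iff V beats_def)
    then show ?thesis by force
  next
    case 2
    then have "apath x [(x, z), (z, y)] y"
      using x y by (auto simp: apath_Cons_iff apath_Nil_iff V beats_def)
    then show ?thesis by force
  next
    case 3
    have "a \<noteq> x" "a \<noteq> z" "a \<noteq> y" using 3 beats_range[of n c] by auto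
    then have "apath x [(x, a), (a, z), (z, y)] y"
      using x y 3 by (auto simp: apath_Cons_iff apath_Nil_iff V beats_def)
    then show ?thesis by force
  qed
qed

text \<open>Some vertex dominates at least half of the other vertices in this set, yet its
  out-degree is below \<open>m\<close>. The \<open>max 0\<close> covers negative \<open>m\<close>,
  where the set is empty.\<close>

lemma card_out_less_le:
  "real (card {x \<in> {1..n}. real (card (out n c x)) < m}) \<le> max 0 (2 * m + 1)"
proof -
  let ?Y = "{x \<in> {1..n}. real (card (out n c x)) < m}"
  show ?thesis
  proof (cases "?Y = {}")
    case False
    \<comment> \<open>The arguments are swapped, so that in-weight under \<open>w\<close> counts
      dominated vertices.\<close>
    define w :: "nat \<Rightarrow> nat \<Rightarrow> real" where "w i j = of_bool (beats n c j i)" for i j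
    obtain y where y: "y \<in> ?Y" "(\<Sum>z\<in>?Y - {y}. w z y) \<ge> (real (card ?Y) - 1) / 2"
    proof (rule exists_large_in_weight[of ?Y w])
      show "w i j + w j i \<ge> 1" if "i \<in> ?Y" "j \<in> ?Y" "i \<noteq> j" for i j
        using beats_total[of i n j c] that by (auto simp: w_def)
    qed (use False in auto)
    have "(\<Sum>z\<in>?Y - {y}. w z y) = card ((?Y - {y}) \<inter> {z. beats n c y z})"
      by (simp add: w_def Int_def)
    also have "\<dots> \<le> card (out n c y)"
      by (auto simp: out_def intro!: card_mono)
    finally show ?thesis using y by auto
  qed (simp only: card.empty of_nat_0 max.cobounded1)
qed

section \<open>The random model\<close>

text \<open>One fixed \<open>n\<close>. Positivity of \<open>p\<close> will hold for all large
  \<open>n\<close>, because n p(n) tends to infinity.\<close>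

locale tournament_model =
  fixes n :: nat and q :: "nat \<Rightarrow> nat \<Rightarrow> real" and p :: real
  assumes q_prob: "\<lbrakk>i \<in> {1..n}; j \<in> {1..n}; i \<noteq> j\<rbrakk> \<Longrightarrow> 0 \<le> q i j \<and> q i j \<le> 1"
    and q_sum: "\<lbrakk>i \<in> {1..n}; j \<in> {1..n}; i \<noteq> j\<rbrakk> \<Longrightarrow> q i j + q j i = 1"
    and q_ge: "\<lbrakk>i \<in> {1..n}; j \<in> {1..n}; i \<noteq> j\<rbrakk> \<Longrightarrow> p \<le> q i j"
    and p_pos: "0 < p"
begin

abbreviation coins :: "(nat \<times> nat \<Rightarrow> bool) pmf" where
  "coins \<equiv> Pi_pmf (upairs n) False (\<lambda>(i, j). bernoulli_pmf (q i j))"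

section \<open>Single arcs and single gates\<close>

lemma prob_beats:
  "\<lbrakk>i \<in> {1..n}; j \<in> {1..n}; i \<noteq> j\<rbrakk> \<Longrightarrow> measure_pmf.prob coins {c. beats n c i j} = q i j"
  using arc_prob[of i n j q] q_prob[of i j] q_sum[of i j]
  by (simp add: random_tournament_def beats_def vimage_def)

lemma prob_not_beats:
  assumes "i \<in> {1..n}" "j \<in> {1..n}" "i \<noteq> j"
  shows "measure_pmf.prob coins {c. \<not> beats n c i j} = 1 - q i j"
  using prob_beats[OF assms] by (simp add: prob_pmf_not)

text \<open>The coins between \<open>A\<close> and \<open>z\<close> are independent, and each factor
  is at most 1 - p, hence at most exp (-p).\<close>

lemma prob_no_beats_from:
  assumes A: "A \<subseteq> {1..n}" and z: "z \<in> {1..n}" "z \<notin> A"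
  shows "measure_pmf.prob coins {c. \<forall>a\<in>A. \<not> beats n c a z} \<le> exp (- (p * real (card A)))"
proof -
  have fin: "finite A" using A finite_subset by blast
  have "measure_pmf.prob coins {c. \<forall>a\<in>A. \<not> beats n c a z}
      = (\<Prod>a\<in>A. measure_pmf.prob coins {c. \<not> beats n c a z})"
    by (rule prob_Pi_pmf_all[where J = "\<lambda>a. {edge a z}"])
      (use A z fin in \<open>auto intro!: edge_in_upairs depends_on_not depends_on_beats
        simp: disjoint_family_on_def edge_eq_iff\<close>)
  also have "\<dots> \<le> (\<Prod>a\<in>A. exp (- p))"
  proof (intro prod_mono conjI)
    fix a assume "a \<in> A"
    then have a: "a \<in> {1..n}" "a \<noteq> z" using A z by auto
    then have "measure_pmf.prob coins {c. \<not> beats n c a z} \<le> 1 + (- p)"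
      using prob_not_beats[of a z] q_ge[of a z] z by simp
    also have "\<dots> \<le> exp (- p)" by (rule exp_ge_add_one_self)
    finally show "measure_pmf.prob coins {c. \<not> beats n c a z} \<le> exp (- p)" .
  qed simp
  also have "\<dots> = exp (- (p * real (card A)))"
    by (simp flip: exp_of_nat_mult add: mult.commute)
  finally show ?thesis .
qed

text \<open>A gate is open with probability at least \<open>q z y / 2\<close>. For
  \<open>z \<notin> A\<close>, the arc from \<open>z\<close> to \<open>y\<close> is independent of
  the coins between \<open>A\<close> and \<open>z\<close> because \<open>y \<notin> A\<close>, and
  \<open>A\<close> misses \<open>z\<close> with probability at most exp (-1), which is below
  1/2.\<close>

lemma prob_not_gate:
  assumes A: "A \<subseteq> {1..n}" and y: "y \<in> {1..n}" "y \<notin> A" and z: "z \<in> {1..n}" "z \<noteq> y"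
    and large: "p * real (card A) \<ge> 1"
  shows "measure_pmf.prob coins {c. \<not> gate n A c y z} \<le> exp (- q z y / 2)"
proof -
  have half: "exp (- 1 :: real) \<le> 1 / 2"
    using exp_ge_add_one_self[of 1] by (simp add: exp_minus field_simps)
  have q: "0 \<le> q z y" "q z y \<le> 1" using q_prob[of z y] y z by auto
  have "measure_pmf.prob coins {c. gate n A c y z} \<ge> q z y / 2"
  proof (cases "z \<in> A")
    case True
    then show ?thesis using prob_beats[of z y] y z q by (simp add: gate_def)
  next
    case False
    let ?E = "{c. \<forall>a\<in>A. \<not> beats n c a z}"
    have "measure_pmf.prob coins ?E \<le> exp (- (p * real (card A)))"
      using A z False by (intro prob_no_beats_from)
    also have "\<dots> \<le> exp (- 1)" using large by simp
    finally have E: "measure_pmf.prob coins ?E \<le> 1 / 2" using half by linarith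
    have "measure_pmf.prob coins {c. beats n c z y \<and> \<not> (\<forall>a\<in>A. \<not> beats n c a z)}
      = measure_pmf.prob coins {c. beats n c z y} * measure_pmf.prob coins {c. \<not> (\<forall>a\<in>A. \<not> beats n c a z)}"
    proof (rule prob_Pi_pmf_conj[where J = "{edge z y}" and K = "(\<lambda>a. edge a z) ` A"])
      show "(\<lambda>a. edge a z) ` A \<subseteq> upairs n"
        using A z False edge_in_upairs[of _ n z] by blast
    qed (use y z in \<open>auto intro!: edge_in_upairs depends_on_not depends_on_all depends_on_beats
        simp: edge_eq_iff simp del: Set.ball_simps\<close>)
    moreover have "measure_pmf.prob coins {c. \<not> (\<forall>a\<in>A. \<not> beats n c a z)} = 1 - measure_pmf.prob coins ?E"
      by (rule prob_pmf_not)
    ultimately have "measure_pmf.prob coins {c. gate n A c y z} = q z y * (1 - measure_pmf.prob coins ?E)"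
      using False prob_beats[of z y] y z by (simp add: gate_def)
    also have "\<dots> \<ge> q z y * (1 / 2)" using E q by (intro mult_left_mono) auto
    finally show ?thesis by simp
  qed
  moreover have "measure_pmf.prob coins {c. \<not> gate n A c y z} = 1 - measure_pmf.prob coins {c. gate n A c y z}"
    by (rule prob_pmf_not)
  ultimately have "measure_pmf.prob coins {c. \<not> gate n A c y z} \<le> 1 + (- q z y / 2)" by simp
  also have "\<dots> \<le> exp (- q z y / 2)" by (rule exp_ge_add_one_self)
  finally show ?thesis .
qed

section \<open>Missing a target from a rich vertex\<close>

text \<open>The vertex \<open>x\<close> is left out because its coins are spent on determining
  \<open>out n c x\<close>.\<close>

definition in_weight :: "nat \<Rightarrow> nat \<Rightarrow> real" where
  "in_weight x y = (\<Sum>z\<in>{1..n} - {x} - {y}. q z y)"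

text \<open>\<open>A\<close> is a parameter rather than \<open>out n c x\<close>: for a fixed
  \<open>A\<close> without \<open>x\<close>, and \<open>y\<close> other than \<open>x\<close>, the
  event reads no coin at \<open>x\<close>.\<close>

definition blocked :: "nat set \<Rightarrow> nat \<Rightarrow> nat \<Rightarrow> (nat \<times> nat \<Rightarrow> bool) \<Rightarrow> bool" where
  "blocked A x y c \<longleftrightarrow> (\<forall>z\<in>{1..n} - {x} - {y}. \<not> gate n A c y z)"

lemma gate_edges_subset:
  assumes "A \<subseteq> {1..n}" "y \<in> {1..n}" "z \<in> {1..n}" "z \<noteq> y"
  shows "gate_edges A y z \<subseteq> upairs n"
  using assms edge_in_upairs[of _ n z] edge_in_upairs[of z n y]
  by (fastforce simp: gate_edges_def split: if_splits)

text \<open>The sets \<open>gate_edges A y z\<close> are disjoint for different \<open>z\<close>, so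
  the gates fail independently and the exponents of the single bounds add up.\<close>

lemma prob_blocked:
  assumes A: "A \<subseteq> {1..n}" and y: "y \<in> {1..n}" "y \<notin> A" and large: "p * real (card A) \<ge> 1"
  shows "measure_pmf.prob coins {c. blocked A x y c} \<le> exp (- in_weight x y / 2)"
proof -
  have "measure_pmf.prob coins {c. blocked A x y c}
      = (\<Prod>z\<in>{1..n} - {x} - {y}. measure_pmf.prob coins {c. \<not> gate n A c y z})"
    unfolding blocked_def
  proof (rule prob_Pi_pmf_all[where J = "gate_edges A y"])
    show "disjoint_family_on (gate_edges A y) ({1..n} - {x} - {y})"
      using y by (auto simp: disjoint_family_on_def gate_edges_def edge_eq_iff split: if_splits)
  qed (use A y in \<open>auto intro: depends_on_not depends_on_gate dest!: subsetD[OF gate_edges_subset, rotated -1]\<close>)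
  also have "\<dots> \<le> (\<Prod>z\<in>{1..n} - {x} - {y}. exp (- q z y / 2))"
    using A y large by (intro prod_mono conjI prob_not_gate) auto
  also have "\<dots> = exp (- in_weight x y / 2)"
    by (simp add: in_weight_def sum_negf sum_divide_distrib flip: exp_sum)
  finally show ?thesis .
qed

text \<open>Conditioning on \<open>out n c x\<close> is harmless because \<open>blocked A x y\<close> involves no pair
  containing \<open>x\<close>.\<close>
lemma prob_out_blocked:
  assumes x: "x \<in> {1..n}" and y: "y \<in> {1..n}" "y \<noteq> x" and large: "p * m \<ge> 1"
  shows "measure_pmf.prob coins
      {c. real (card (out n c x)) \<ge> m \<and> y \<notin> out n c x \<and> blocked (out n c x) x y c}
    \<le> exp (- in_weight x y / 2)"
proof -
  \<comment> \<open>The event is partitioned by the value \<open>A\<close> of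
    \<open>out n c x\<close>, which never contains \<open>x\<close>.\<close>
  define \<A> where "\<A> = {A \<in> Pow ({1..n} - {x}). real (card A) \<ge> m \<and> y \<notin> A}"
  have fin: "finite \<A>" by (simp add: \<A>_def)
  have split: "{c. real (card (out n c x)) \<ge> m \<and> y \<notin> out n c x \<and> blocked (out n c x) x y c}
      = (\<Union>A\<in>\<A>. {c. out n c x = A \<and> blocked A x y c})"
    using beats_range by (fastforce simp: \<A>_def out_def)
  have "measure_pmf.prob coins (\<Union>A\<in>\<A>. {c. out n c x = A \<and> blocked A x y c})
      = (\<Sum>A\<in>\<A>. measure_pmf.prob coins {c. out n c x = A \<and> blocked A x y c})"
    using fin by (intro measure_pmf.finite_measure_finite_Union) (auto simp: disjoint_family_on_def)
  also have "\<dots> \<le> (\<Sum>A\<in>\<A>. measure_pmf.prob coins {c. out n c x = A} * exp (- in_weight x y / 2))"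
  proof (rule sum_mono)
    fix A assume "A \<in> \<A>"
    then have A: "A \<subseteq> {1..n}" "x \<notin> A" "y \<notin> A" and card: "real (card A) \<ge> m"
      by (auto simp: \<A>_def)
    have "p * real (card A) \<ge> p * m" using card p_pos by (intro mult_left_mono) auto
    with large have large': "p * real (card A) \<ge> 1" by simp
    have "measure_pmf.prob coins {c. out n c x = A \<and> blocked A x y c}
        = measure_pmf.prob coins {c. out n c x = A} * measure_pmf.prob coins {c. blocked A x y c}"
    proof (rule prob_Pi_pmf_conj[where J = "(\<lambda>z. edge x z) ` ({1..n} - {x})"
            and K = "\<Union>(gate_edges A y ` ({1..n} - {x} - {y}))"])
      show "(\<lambda>z. edge x z) ` ({1..n} - {x}) \<inter> \<Union>(gate_edges A y ` ({1..n} - {x} - {y})) = {}"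
        using A y by (auto simp: gate_edges_def edge_eq_iff split: if_splits)
      show "depends_on (\<Union>(gate_edges A y ` ({1..n} - {x} - {y}))) (blocked A x y)"
        unfolding blocked_def
        by (intro depends_on_all depends_on_not depends_on_mono[OF depends_on_gate]) blast
      show "\<Union>(gate_edges A y ` ({1..n} - {x} - {y})) \<subseteq> upairs n"
        using gate_edges_subset[OF A(1) y(1)] by blast
    qed (use x in \<open>auto simp del: One_nat_def intro!: edge_in_upairs depends_on_out\<close>)
    also have "\<dots> \<le> measure_pmf.prob coins {c. out n c x = A} * exp (- in_weight x y / 2)"
      using prob_blocked[OF A(1) y(1) A(3) large', of x] by (intro mult_left_mono) auto
    finally show "measure_pmf.prob coins {c. out n c x = A \<and> blocked A x y c}
      \<le> measure_pmf.prob coins {c. out n c x = A} * exp (- in_weight x y / 2)" .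
  qed
  \<comment> \<open>Different values of \<open>out n c x\<close> exclude each other, so their
    probabilities sum to that of a union, at most 1.\<close>
  also have "\<dots> = measure_pmf.prob coins (\<Union>A\<in>\<A>. {c. out n c x = A}) * exp (- in_weight x y / 2)"
    using fin
    by (subst measure_pmf.finite_measure_finite_Union)
      (auto simp: disjoint_family_on_def sum_distrib_right)
  also have "\<dots> \<le> 1 * exp (- in_weight x y / 2)"
    by (intro mult_right_mono) auto
  finally show ?thesis by (simp add: split)
qed

section \<open>From missed targets to the number of 3-kings\<close>

text \<open>Union bound over the targets \<open>y\<close>. After removal of \<open>x\<close>, each
  in-weight has n - 2 summands of size at least \<open>p\<close>, so
  \<open>sum_exp_in_weight_le\<close> applies with D = (n - 2) p.\<close>

lemma prob_not_king:
  assumes x: "x \<in> {1..n}" and large: "p * m \<ge> 1"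
  shows "measure_pmf.prob coins {c. real (card (out n c x)) \<ge> m \<and> \<not> three_king (tournament_of n c) x}
    \<le> exp (- ((real n - 2) * p) / 4) / (1 - exp (- 1 / 8))"
proof -
  let ?V = "{1..n} - {x}"
  let ?B = "\<lambda>y. {c. real (card (out n c x)) \<ge> m \<and> y \<notin> out n c x \<and> blocked (out n c x) x y c}"
  have "{c. real (card (out n c x)) \<ge> m \<and> \<not> three_king (tournament_of n c) x} \<subseteq> (\<Union>y\<in>?V. ?B y)"
  proof safe
    fix c assume c: "real (card (out n c x)) \<ge> m" "\<not> three_king (tournament_of n c) x"
    then obtain y where y: "y \<in> {1..n}" "y \<noteq> x"
      "\<not> (\<exists>w. pre_digraph.apath (with_proj (tournament_of n c)) x w y \<and> length w \<le> 3)"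
      using x by (auto simp: three_king_def tournament_of_def)
    then have "y \<notin> out n c x \<and> blocked (out n c x) x y c"
      using short_path_if_gate[OF x y(1,2), of c] by (auto simp: blocked_def)
    with y c show "c \<in> (\<Union>y\<in>?V. ?B y)" by auto
  qed
  then have "measure_pmf.prob coins {c. real (card (out n c x)) \<ge> m \<and> \<not> three_king (tournament_of n c) x}
      \<le> measure_pmf.prob coins (\<Union>y\<in>?V. ?B y)"
    by (intro measure_pmf.finite_measure_mono) auto
  also have "\<dots> \<le> (\<Sum>y\<in>?V. measure_pmf.prob coins (?B y))"
    by (intro measure_pmf.finite_measure_subadditive_finite) auto
  also have "\<dots> \<le> (\<Sum>y\<in>?V. exp (- (\<Sum>z\<in>?V - {y}. q z y) / 2))"
    using prob_out_blocked[OF x _ _ large] by (intro sum_mono) (auto simp: in_weight_def)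
  also have "\<dots> \<le> exp (- ((real n - 2) * p) / 4) / (1 - exp (- 1 / 8))"
  proof (rule sum_exp_in_weight_le)
    fix y assume y: "y \<in> ?V"
    have "card (?V - {y}) = n - 2" "n \<ge> 2" using x y by auto
    then have "(real n - 2) * p = (\<Sum>z\<in>?V - {y}. p)" by (simp add: of_nat_diff)
    also have "\<dots> \<le> (\<Sum>z\<in>?V - {y}. q z y)" using y by (intro sum_mono q_ge) auto
    finally show "(real n - 2) * p \<le> (\<Sum>z\<in>?V - {y}. q z y)" .
  qed (use q_prob q_sum in auto)
  finally show ?thesis .
qed

text \<open>At most 0.08 n + 1 vertices are not rich. By Markov's inequality, fewer than 0.01 n rich
  vertices fail to be 3-kings outside an event of small probability. This leaves more than 0.91 n -
  1 3-kings, which is at least 0.9 n once n is at least 100.\<close>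

lemma prob_few_kings:
  assumes n: "n \<ge> 100" and large: "p * (0.04 * real n) \<ge> 1"
  shows "measure_pmf.prob (random_tournament n q)
      {T. real (card {x \<in> pverts T. three_king T x}) \<ge> 0.9 * real n}
    \<ge> 1 - 100 / (1 - exp (- 1 / 8)) * exp (- (real n * p) / 8)"
proof -
  let ?m = "0.04 * real n" and ?\<delta> = "exp (- ((real n - 2) * p) / 4) / (1 - exp (- 1 / 8))"
  let ?bad = "\<lambda>x. {c. real (card (out n c x)) \<ge> ?m \<and> \<not> three_king (tournament_of n c) x}"
  \<comment> \<open>\<open>N\<close> counts the rich vertices that are not 3-kings.\<close>
  define N where "N c = (\<Sum>x\<in>{1..n}. indicator (?bad x) c :: real)" for c
  have V: "pverts (tournament_of n c) = {1..n}" for c by (simp add: tournament_of_def)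
  have int: "integrable (measure_pmf coins) (\<lambda>c. indicator (?bad x) c :: real)" for x
    by (intro measure_pmf.integrable_const_bound[where B = 1]) auto
  have "measure_pmf.expectation coins N = (\<Sum>x\<in>{1..n}. measure_pmf.prob coins (?bad x))"
    unfolding N_def using int by (subst Bochner_Integration.integral_sum) auto
  also have "\<dots> \<le> (\<Sum>x\<in>{1..n}. ?\<delta>)"
    using large by (intro sum_mono prob_not_king) auto
  finally have EN: "measure_pmf.expectation coins N \<le> real n * ?\<delta>" by simp
  have "measure_pmf.prob coins {c. N c \<ge> 0.01 * real n} \<le> measure_pmf.expectation coins N / (0.01 * real n)"
  proof -
    have "integrable (measure_pmf coins) N" unfolding N_def using int by auto
    moreover have "N c \<ge> 0" for c unfolding N_def by (simp add: sum_nonneg)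
    ultimately show ?thesis
      using integral_Markov_inequality_measure[of "measure_pmf coins" N "{}" "0.01 * real n"] n by simp
  qed
  also have "\<dots> \<le> real n * ?\<delta> / (0.01 * real n)"
    using EN by (intro divide_right_mono) auto
  also have "\<dots> = 100 * ?\<delta>" using n by simp
  also have "\<dots> \<le> 100 / (1 - exp (- 1 / 8)) * exp (- (real n * p) / 8)"
  proof -
    \<comment> \<open>Since n <= 2 (n - 2), the denominator 4 is relaxed to 8 to replace n - 2 by
      n.\<close>
    have "real n * p \<le> 2 * ((real n - 2) * p)"
      using n p_pos mult_right_mono[of "real n" "2 * (real n - 2)" p] by (simp add: algebra_simps)
    then have "- ((real n - 2) * p) / 4 \<le> - (real n * p) / 8" by linarith
    then have "exp (- ((real n - 2) * p) / 4) \<le> exp (- (real n * p) / 8)" by (simp only: exp_le_cancel_iff)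
    then show ?thesis by (simp add: divide_right_mono)
  qed
  finally have *: "measure_pmf.prob coins {c. N c \<ge> 0.01 * real n}
      \<le> 100 / (1 - exp (- 1 / 8)) * exp (- (real n * p) / 8)" .
  have "{c. \<not> N c \<ge> 0.01 * real n}
      \<subseteq> {c. real (card {x \<in> pverts (tournament_of n c). three_king (tournament_of n c) x}) \<ge> 0.9 * real n}"
  proof safe
    fix c assume "\<not> N c \<ge> 0.01 * real n"
    let ?K = "{x \<in> {1..n}. three_king (tournament_of n c) x}"
    let ?L = "{x \<in> {1..n}. real (card (out n c x)) < ?m}"
    let ?B = "{x \<in> {1..n}. c \<in> ?bad x}"
    have "N c = real (card ?B)"
      unfolding N_def by (simp add: indicator_def Int_def)
    with \<open>\<not> _\<close> have B: "real (card ?B) < 0.01 * real n" by simp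
    have L: "real (card ?L) \<le> 2 * ?m + 1" using card_out_less_le[of n c ?m] by simp
    \<comment> \<open>Every vertex is a 3-king, is not rich, or is counted by
      \<open>N\<close>.\<close>
    have "card {1..n} \<le> card (?K \<union> ?L \<union> ?B)" by (intro card_mono) auto
    also have "\<dots> \<le> card ?K + card ?L + card ?B"
      by (meson add_le_mono card_Un_le le_refl order_trans)
    finally have "real n \<le> real (card ?K) + real (card ?L) + real (card ?B)" by simp
    with B L n show "0.9 * real n \<le> real (card {x \<in> pverts (tournament_of n c). three_king (tournament_of n c) x})"
      unfolding V by simp
  qed
  then have "measure_pmf.prob coins {c. \<not> N c \<ge> 0.01 * real n} \<le> measure_pmf.prob (random_tournament n q)
      {T. real (card {x \<in> pverts T. three_king T x}) \<ge> 0.9 * real n}"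
    unfolding random_tournament_def measure_map_pmf
    by (intro measure_pmf.finite_measure_mono) auto
  moreover have "measure_pmf.prob coins {c. \<not> N c \<ge> 0.01 * real n} = 1 - measure_pmf.prob coins {c. N c \<ge> 0.01 * real n}"
    by (rule prob_pmf_not)
  ultimately show ?thesis using * by linarith
qed

end

section \<open>Passage to the limit\<close>

theorem theorem9:
  fixes p :: "nat \<Rightarrow> real" and q :: "nat \<Rightarrow> nat \<Rightarrow> nat \<Rightarrow> real"
  assumes "filterlim (\<lambda>n. real n * p n) at_top sequentially"
    and "\<And>n i j. \<lbrakk>i \<in> {1..n}; j \<in> {1..n}; i \<noteq> j\<rbrakk> \<Longrightarrow> 0 \<le> q n i j \<and> q n i j \<le> 1"
    and "\<And>n i j. \<lbrakk>i \<in> {1..n}; j \<in> {1..n}; i \<noteq> j\<rbrakk> \<Longrightarrow> q n i j + q n j i = 1"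
    and "\<And>n i j. \<lbrakk>i \<in> {1..n}; j \<in> {1..n}; i \<noteq> j\<rbrakk> \<Longrightarrow> p n \<le> q n i j"
  shows "(\<lambda>n. measure_pmf.prob (random_tournament n (q n))
            {T. real (card {x \<in> pverts T. three_king T x}) \<ge> 0.9 * real n}) \<longlonglongrightarrow> 1"
proof (rule tendsto_sandwich[where h = "\<lambda>_. 1"])
  let ?C = "100 / (1 - exp (- 1 / 8)) :: real"
  have "filterlim (\<lambda>n. - (real n * p n) / 8) at_bot sequentially"
  proof -
    have "filterlim (\<lambda>n. (1 / 8) * (real n * p n)) at_top sequentially"
      using assms(1) by (intro filterlim_tendsto_pos_mult_at_top[OF tendsto_const]) auto
    then show ?thesis by (simp add: filterlim_uminus_at_top)
  qed
  then have "(\<lambda>n. exp (- (real n * p n) / 8)) \<longlonglongrightarrow> 0"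
    by (rule filterlim_compose[OF exp_at_bot])
  then have "(\<lambda>n. 1 - ?C * exp (- (real n * p n) / 8)) \<longlonglongrightarrow> 1 - ?C * 0"
    by (intro tendsto_intros)
  then show "(\<lambda>n. 1 - ?C * exp (- (real n * p n) / 8)) \<longlonglongrightarrow> 1" by simp
  \<comment> \<open>The threshold 25 is 1 / 0.04, which makes p times the richness bound 0.04 n at
    least 1; it also forces p(n) to be positive.\<close>
  have "eventually (\<lambda>n. real n * p n \<ge> 25) sequentially"
    using assms(1) by (auto simp: filterlim_at_top)
  then show "\<forall>\<^sub>F n in sequentially. 1 - ?C * exp (- (real n * p n) / 8)
      \<le> measure_pmf.prob (random_tournament n (q n))
          {T. real (card {x \<in> pverts T. three_king T x}) \<ge> 0.9 * real n}"
    using eventually_ge_at_top[of 100]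
  proof eventually_elim
    case (elim n)
    then have "p n > 0"
      by (metis less_le_trans of_nat_0_le_iff zero_less_mult_pos zero_less_numeral of_nat_0_less_iff)
    interpret tournament_model n "q n" "p n"
      by standard (use assms(2-4) \<open>p n > 0\<close> in auto)
    show ?case
      using elim by (intro prob_few_kings) (simp_all add: mult.commute)
  qed
qed simp_all

end
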